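(* For each integer $d \ge 1$, there exist constants $C,c>0$ such that for all $n$ (for which $\mathsf{F}_{d,n}$ is defined) and all $x>0$ $$\mathbb{P}\left(\mathrm{H}(\mathsf{F}_{d,n}) \ge x\right) \le C \exp(-cx^2/n).$$
   Context: Let $\mathcal{F}_1$ be the class of finite (unlabelled, non-empty) rooted trees in which each vertex has either no child, or only a left child, or only a right child, or both a left and a right child. For $d \ge 2$, an element of the class $\mathcal{F}_d$ consists of a tree $T$ from $\mathcal{F}_1$ (the first level) together with, for each vertex $v$ of $T$, a tree $T_v$ from $\mathcal{F}_{d-1}$, where $v$ is joined by an additional edge to the root of $T_v$. The root of the resulting tree is the root of $T$, and its size is its total number of vertices. Equivalently, the generating series $F_d(x)=\sum_n f_{d,n}x^n$ of the numbers $f_{d,n}$ of $n$-vertex trees in $\mathcal{F}_d$ satisfy $F_1(x)=x(1+2F_1(x)+F_1(x)^2)$ and $F_d(x)=F_1(xF_{d-1}(x))$ for $d\ge 2$. For $n$ such that $f_{d,n}>0$ (i.e. $n \ge d$), $\mathsf{F}_{d,n}$ denotes a uniformly random $n$-vertex tree in $\mathcal{F}_d$. The height $\mathrm{H}(T)$ of a rooted tree $T$ is the maximal graph distance of a vertex from the root. *)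

theory Defs
  imports "HOL-Library.Tree" "HOL-Probability.Probability"
begin

text \<open>
  A tree with one level is a nonempty binary tree from \<^theory>\<open>HOL-Library.Tree\<close>: the vertices
  are the \<^const>\<open>Node\<close>s, and \<^const>\<open>Leaf\<close> stands for an absent child. A tree with more levels is
  a first-level binary tree in which each vertex \<open>v\<close> carries, as its label, the tree \<open>T\<^sub>v\<close>
  attached to it.
\<close>

datatype mtree = Base "unit tree" | Level "mtree tree"

text \<open>The index \<open>0\<close> is junk; the classes of interest have \<open>d \<ge> 1\<close>.\<close>

fun tree_class :: "nat \<Rightarrow> mtree set" where
  "tree_class 0 = {}"
| "tree_class (Suc 0) = {Base T | T. T \<noteq> Leaf}"
| "tree_class (Suc (Suc d)) = {Level T | T. T \<noteq> Leaf \<and> set_tree T \<subseteq> tree_class (Suc d)}"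

text \<open>
  A vertex of a binary tree is addressed by the sequence of left/right steps leading to it from
  the root; \<open>label_at T p\<close> is \<open>None\<close> if there is no vertex at \<open>p\<close>.
\<close>

datatype dir = Lft | Rgt

fun label_at :: "'a tree \<Rightarrow> dir list \<Rightarrow> 'a option" where
  "label_at Leaf p = None"
| "label_at (Node l a r) [] = Some a"
| "label_at (Node l a r) (Lft # p) = label_at l p"
| "label_at (Node l a r) (Rgt # p) = label_at r p"

definition positions :: "'a tree \<Rightarrow> dir list set" where
  "positions T = dom (label_at T)"

text \<open>
  The underlying rooted graph. The vertex \<open>p\<close> of the first level is represented by \<open>[p]\<close>, and
  the vertex \<open>w\<close> of the tree attached to \<open>p\<close> by \<open>p # w\<close>. Thus the root is always \<open>[[]]\<close>, and
  \<open>[p, []]\<close> is the root of the tree attached to \<open>p\<close>.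
\<close>

type_synonym vertex = "dir list list"

inductive is_vertex :: "mtree \<Rightarrow> vertex \<Rightarrow> bool" where
  base: "p \<in> positions T \<Longrightarrow> is_vertex (Base T) [p]"
| first_level: "p \<in> positions T \<Longrightarrow> is_vertex (Level T) [p]"
| attached: "label_at T p = Some t \<Longrightarrow> is_vertex t w \<Longrightarrow> is_vertex (Level T) (p # w)"

inductive is_child :: "mtree \<Rightarrow> vertex \<Rightarrow> vertex \<Rightarrow> bool" where
  base: "p \<in> positions T \<Longrightarrow> p @ [b] \<in> positions T \<Longrightarrow> is_child (Base T) [p] [p @ [b]]"
| first_level: "p \<in> positions T \<Longrightarrow> p @ [b] \<in> positions T \<Longrightarrow> is_child (Level T) [p] [p @ [b]]"
| joining: "p \<in> positions T \<Longrightarrow> is_child (Level T) [p] [p, []]"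
| attached: "label_at T p = Some t \<Longrightarrow> is_child t u w \<Longrightarrow> is_child (Level T) (p # u) (p # w)"

definition vertices :: "mtree \<Rightarrow> vertex set" where
  "vertices t = {v. is_vertex t v}"

definition adjacency :: "mtree \<Rightarrow> (vertex \<times> vertex) set" where
  "adjacency t = {(u, v). is_child t u v \<or> is_child t v u}"

definition tree_root :: vertex where
  "tree_root = [[]]"

definition num_vertices :: "mtree \<Rightarrow> nat" where
  "num_vertices t = card (vertices t)"

text \<open>\<open>(u, v) \<in> adjacency t ^^ k\<close> means that there is a walk of length \<open>k\<close> from \<open>u\<close> to \<open>v\<close>.\<close>

definition graph_dist :: "mtree \<Rightarrow> vertex \<Rightarrow> vertex \<Rightarrow> nat" where
  "graph_dist t u v = (LEAST k. (u, v) \<in> adjacency t ^^ k)"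

definition tree_height :: "mtree \<Rightarrow> nat" where
  "tree_height t = Max (graph_dist t tree_root ` vertices t)"

definition trees_of_size :: "nat \<Rightarrow> nat \<Rightarrow> mtree set" where
  "trees_of_size d n = {t \<in> tree_class d. num_vertices t = n}"

text \<open>
  Only meaningful if \<^term>\<open>trees_of_size d n \<noteq> {}\<close>; finiteness, and the fact that this holds exactly
  for \<open>n \<ge> d\<close>, are shown below.
\<close>

definition random_tree :: "nat \<Rightarrow> nat \<Rightarrow> mtree pmf" where
  "random_tree d n = pmf_of_set (trees_of_size d n)"


text \<open>
  Well-definedness: sizes and heights are cardinalities and maxima of finite nonempty sets, every
  vertex is reachable from the root, and the uniform distributions above exist for \<open>n \<ge> d \<ge> 1\<close>.
\<close>

lemma positions_Leaf [simp]: "positions Leaf = {}"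
  by (simp add: positions_def dom_def)

lemma positions_Node:
  "positions (Node l a r) = insert [] (Cons Lft ` positions l \<union> Cons Rgt ` positions r)"
proof -
  have "p \<in> positions (Node l a r) \<longleftrightarrow>
      p \<in> insert [] (Cons Lft ` positions l \<union> Cons Rgt ` positions r)" for p
  proof (cases p)
    case (Cons b q)
    then show ?thesis by (cases b) (auto simp: positions_def)
  qed (auto simp: positions_def)
  then show ?thesis by blast
qed

lemma finite_positions [simp]: "finite (positions T)"
  by (induction T) (auto simp: positions_Node)

lemma card_positions: "card (positions T) = size T"
proof (induction T)
  case (Node l a r)
  have "card (Cons Lft ` positions l \<union> Cons Rgt ` positions r) = size l + size r"
    using Node by (subst card_Un_disjoint) (auto simp: card_image)
  moreover have "[] \<notin> Cons Lft ` positions l \<union> Cons Rgt ` positions r" by auto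
  ultimately show ?case by (simp add: positions_Node card_insert_if)
qed simp

lemma Nil_in_positions [simp]: "[] \<in> positions T \<longleftrightarrow> T \<noteq> Leaf"
  by (cases T) (auto simp: positions_Node)

lemma positions_prefix: "p @ q \<in> positions T \<Longrightarrow> p \<in> positions T"
proof (induction T arbitrary: p)
  case (Node l a r)
  then show ?case by (cases p) (auto simp: positions_Node)
qed simp

lemma label_at_in_set_tree: "label_at T p = Some a \<Longrightarrow> a \<in> set_tree T"
proof (induction T arbitrary: p)
  case (Node l a r)
  then show ?case
  proof (cases p)
    case (Cons b q)
    then show ?thesis using Node by (cases b) auto
  qed auto
qed simp

lemma in_set_tree_label_at: "a \<in> set_tree T \<Longrightarrow> \<exists>p. label_at T p = Some a"
proof (induction T)
  case (Node l b r)
  then consider "a = b" | "\<exists>p. label_at l p = Some a" | "\<exists>p. label_at r p = Some a"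
    by auto
  then show ?case
  proof cases
    case 1
    then show ?thesis by (intro exI[of _ "[]"]) simp
  next
    case 2
    then obtain p where "label_at l p = Some a" by blast
    then show ?thesis by (intro exI[of _ "Lft # p"]) simp
  next
    case 3
    then obtain p where "label_at r p = Some a" by blast
    then show ?thesis by (intro exI[of _ "Rgt # p"]) simp
  qed
qed simp

lemma is_vertex_Base_iff: "is_vertex (Base T) v \<longleftrightarrow> (\<exists>p \<in> positions T. v = [p])"
  by (subst is_vertex.simps) auto

lemma is_vertex_Level_iff:
  "is_vertex (Level T) v \<longleftrightarrow> (\<exists>p \<in> positions T. v = [p]) \<or>
     (\<exists>p t w. label_at T p = Some t \<and> is_vertex t w \<and> v = p # w)"
  by (subst is_vertex.simps) auto

lemma vertices_Base: "vertices (Base T) = (\<lambda>p. [p]) ` positions T"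
  by (auto simp: vertices_def is_vertex_Base_iff)

lemma vertices_Level:
  "vertices (Level T) = (\<lambda>p. [p]) ` positions T \<union>
     (\<Union>p\<in>positions T. Cons p ` vertices (the (label_at T p)))"
proof (rule set_eqI)
  fix v
  show "v \<in> vertices (Level T) \<longleftrightarrow> v \<in> (\<lambda>p. [p]) ` positions T \<union>
     (\<Union>p\<in>positions T. Cons p ` vertices (the (label_at T p)))"
    by (force simp: vertices_def is_vertex_Level_iff positions_def dom_def)
qed

lemma Nil_notin_vertices [simp]: "[] \<notin> vertices t"
  by (cases t) (auto simp: vertices_Base vertices_Level)

lemma finite_vertices [simp]: "finite (vertices t)"
proof (induction t)
  case (Level T)
  have "finite (vertices (the (label_at T p)))" if "p \<in> positions T" for p
    using that Level label_at_in_set_tree by (fastforce simp: positions_def)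
  then show ?case by (simp add: vertices_Level)
qed (auto simp: vertices_Base)

lemma num_vertices_Base: "num_vertices (Base T) = size T"
  by (simp add: num_vertices_def vertices_Base card_image card_positions inj_on_def)

lemma num_vertices_Level:
  "num_vertices (Level T) =
     size T + (\<Sum>p\<in>positions T. num_vertices (the (label_at T p)))"
proof -
  let ?B = "\<Union>p\<in>positions T. Cons p ` vertices (the (label_at T p))"
  have "card ?B = (\<Sum>p\<in>positions T. card (Cons p ` vertices (the (label_at T p))))"
    by (rule card_UN_disjoint) auto
  also have "\<dots> = (\<Sum>p\<in>positions T. num_vertices (the (label_at T p)))"
    by (simp add: card_image num_vertices_def)
  finally have "card ?B = (\<Sum>p\<in>positions T. num_vertices (the (label_at T p)))" .
  moreover have "card ((\<lambda>p. [p]) ` positions T) = size T"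
    by (simp add: card_image card_positions inj_on_def)
  moreover have "(\<lambda>p. [p]) ` positions T \<inter> ?B = {}" by auto
  ultimately show ?thesis
    unfolding num_vertices_def vertices_Level by (subst card_Un_disjoint) auto
qed

lemma num_vertices_label_le:
  assumes "t \<in> set_tree T"
  shows "size T + num_vertices t \<le> num_vertices (Level T)"
proof -
  obtain p where p: "label_at T p = Some t" using in_set_tree_label_at assms by metis
  then have "p \<in> positions T" by (auto simp: positions_def)
  then have "num_vertices (the (label_at T p)) \<le>
      (\<Sum>p\<in>positions T. num_vertices (the (label_at T p)))"
    by (intro member_le_sum) auto
  then show ?thesis by (simp add: num_vertices_Level p)
qed

lemma finite_trees_bounded:
  assumes "finite A"
  shows "finite {T. size T \<le> n \<and> set_tree T \<subseteq> A}"
proof (induction n)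
  case (Suc n)
  let ?S = "{T. size T \<le> n \<and> set_tree T \<subseteq> A}"
  have "{T. size T \<le> Suc n \<and> set_tree T \<subseteq> A} \<subseteq>
      insert Leaf ((\<lambda>(l, a, r). Node l a r) ` (?S \<times> A \<times> ?S))"
  proof
    fix T assume T: "T \<in> {T. size T \<le> Suc n \<and> set_tree T \<subseteq> A}"
    show "T \<in> insert Leaf ((\<lambda>(l, a, r). Node l a r) ` (?S \<times> A \<times> ?S))"
    proof (cases T)
      case (Node l a r)
      then have "(l, a, r) \<in> ?S \<times> A \<times> ?S" using T by auto
      then show ?thesis using Node by (intro insertI2 image_eqI[of _ _ "(l, a, r)"]) simp_all
    qed simp
  qed
  moreover have "finite (insert Leaf ((\<lambda>(l, a, r). Node l a r) ` (?S \<times> A \<times> ?S)))"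
    using Suc assms by (intro finite.insertI finite_imageI finite_cartesian_product)
  ultimately show ?case by (rule finite_subset)
next
  case 0
  have "{T. size T \<le> 0 \<and> set_tree T \<subseteq> A} \<subseteq> {Leaf}" by auto
  then show ?case by (rule finite_subset) simp
qed

lemma finite_tree_class_le: "finite {t \<in> tree_class d. num_vertices t \<le> n}"
proof (induction d rule: tree_class.induct)
  case 2
  have "{t \<in> tree_class (Suc 0). num_vertices t \<le> n} \<subseteq>
      Base ` {T. size T \<le> n \<and> set_tree T \<subseteq> UNIV}"
    by (auto simp: num_vertices_Base)
  moreover have "finite {T :: unit tree. size T \<le> n \<and> set_tree T \<subseteq> UNIV}"
    by (intro finite_trees_bounded) simp
  ultimately show ?case by (rule finite_subset[OF _ finite_imageI])
next
  case (3 d)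
  let ?A = "{t \<in> tree_class (Suc d). num_vertices t \<le> n}"
  have "{t \<in> tree_class (Suc (Suc d)). num_vertices t \<le> n} \<subseteq>
      Level ` {T. size T \<le> n \<and> set_tree T \<subseteq> ?A}"
  proof
    fix t assume t: "t \<in> {t \<in> tree_class (Suc (Suc d)). num_vertices t \<le> n}"
    then obtain T where T: "t = Level T" "set_tree T \<subseteq> tree_class (Suc d)" by auto
    have "size T \<le> n" using t T by (simp add: num_vertices_Level)
    moreover have "num_vertices s \<le> n" if "s \<in> set_tree T" for s
      using num_vertices_label_le[OF that] t T by simp
    ultimately show "t \<in> Level ` {T. size T \<le> n \<and> set_tree T \<subseteq> ?A}" using T by auto
  qed
  then show ?case using finite_trees_bounded[OF 3] by (rule finite_subset[OF _ finite_imageI])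
qed simp

lemma finite_trees_of_size [simp]: "finite (trees_of_size d n)"
  by (rule finite_subset[OF _ finite_tree_class_le[of d n]]) (auto simp: trees_of_size_def)

lemma tree_class_num_vertices_ge: "t \<in> tree_class d \<Longrightarrow> d \<le> num_vertices t"
proof (induction d arbitrary: t rule: tree_class.induct)
  case 2
  then show ?case by (auto simp: num_vertices_Base Suc_le_eq neq_Leaf_iff)
next
  case (3 d)
  then obtain T where T: "t = Level T" "T \<noteq> Leaf" "set_tree T \<subseteq> tree_class (Suc d)" by auto
  then obtain l a r where "T = Node l a r" by (cases T) auto
  then show ?case using 3(1)[of a] T num_vertices_label_le[of a T] by auto
qed simp

lemma trees_of_size_nonempty_iff: "d \<ge> 1 \<Longrightarrow> trees_of_size d n \<noteq> {} \<longleftrightarrow> d \<le> n"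
proof
  assume "trees_of_size d n \<noteq> {}"
  then show "d \<le> n" using tree_class_num_vertices_ge by (auto simp: trees_of_size_def)
next
  assume "d \<ge> 1" "d \<le> n"
  then have "\<exists>t \<in> tree_class d. num_vertices t = n"
  proof (induction d arbitrary: n rule: tree_class.induct)
    case 2
    have "\<exists>T :: unit tree. size T = n"
    proof (induction n)
      case 0
      show ?case by (rule exI[of _ Leaf]) simp
    next
      case (Suc n)
      then obtain T :: "unit tree" where "size T = n" by blast
      then show ?case by (intro exI[of _ "Node T () Leaf"]) simp
    qed
    then obtain T :: "unit tree" where "size T = n" by blast
    then show ?case using 2 by (intro bexI[of _ "Base T"]) (auto simp: num_vertices_Base)
  next
    case (3 d)
    then have "\<exists>t \<in> tree_class (Suc d). num_vertices t = n - 1"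
      by (intro "3.IH") auto
    then obtain t where t: "t \<in> tree_class (Suc d)" "num_vertices t = n - 1" by blast
    have "num_vertices (Level (Node Leaf t Leaf)) = n"
      using "3.prems" t by (simp add: num_vertices_Level positions_Node)
    then show ?case using t by (intro bexI[of _ "Level (Node Leaf t Leaf)"]) auto
  qed simp
  then show "trees_of_size d n \<noteq> {}" by (auto simp: trees_of_size_def)
qed

lemma reachable_lift:
  assumes "label_at T p = Some t" "(u, v) \<in> (adjacency t)\<^sup>*"
  shows "(p # u, p # v) \<in> (adjacency (Level T))\<^sup>*"
  using assms(2)
proof (induction rule: rtrancl_induct)
  case (step v w)
  then have "(p # v, p # w) \<in> adjacency (Level T)"
    using assms(1) by (auto simp: adjacency_def intro: is_child.intros)
  then show ?case using step by auto
qed simp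

lemma reachable_first_level:
  assumes "p \<in> positions T"
    and "\<And>p b. p \<in> positions T \<Longrightarrow> p @ [b] \<in> positions T \<Longrightarrow> is_child t [p] [p @ [b]]"
  shows "(tree_root, [p]) \<in> (adjacency t)\<^sup>*"
  using assms(1)
proof (induction p rule: rev_induct)
  case (snoc b p)
  have p: "p \<in> positions T" using snoc.prems positions_prefix by blast
  then have "([p], [p @ [b]]) \<in> adjacency t"
    using assms(2) snoc.prems by (auto simp: adjacency_def)
  then show ?case using snoc.IH[OF p] by (rule rtrancl_into_rtrancl[rotated])
qed (simp add: tree_root_def)

lemma reachable_from_root:
  assumes "is_vertex t v"
  shows "(tree_root, v) \<in> (adjacency t)\<^sup>*"
  using assms
proof (induction rule: is_vertex.induct)
  case (attached T p t w)
  have p: "p \<in> positions T" using attached by (auto simp: positions_def)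
  have "([p], p # tree_root) \<in> adjacency (Level T)"
    using p by (auto simp: adjacency_def tree_root_def intro: is_child.intros)
  then show ?case
    using reachable_first_level[OF p is_child.first_level] reachable_lift[OF attached(1,3)]
    by (meson rtrancl.rtrancl_into_rtrancl rtrancl_trans)
qed (auto intro: reachable_first_level is_child.intros)

end

theory Submission
  imports Defs
begin

text \<open>
  In a binary tree every step down goes left or right, so the height is at most the sum of the left
  depths of the tree and of its mirror image. The left depth is essentially the maximal stack height
  in a depth-first traversal, that is, the maximum of a lattice path, and the reflection principle
  bounds the number of binary trees with large left depth. This settles \<open>d = 1\<close>.

  For more levels, the height is at most that of the first level plus the maximal height of an
  attached tree. Given the list of attached trees, the first level is a uniform binary tree with
  \<open>k \<le> n\<close> vertices. Given the first level and the sizes \<open>n\<^sub>v\<close>, the attached trees are independent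
  and uniform, and \<open>exp (- a / n\<^sub>v) \<le> (2 / a) * exp (- a / (2 * n)) * n\<^sub>v\<close>. Since the \<open>n\<^sub>v\<close> add up to at most \<open>n\<close>
  and one may assume \<open>a > n\<close>, the union bound loses only a constant factor.
\<close>

text \<open>Left steps to absent children count too, so a single vertex has left depth 1, matching
  the convention of \<open>height\<close>.\<close>

fun left_depth :: "'a tree \<Rightarrow> nat" where
  "left_depth Leaf = 0"
| "left_depth (Node l a r) = max (Suc (left_depth l)) (left_depth r)"

lemma height_le_left_depths: "height T \<le> left_depth T + left_depth (mirror T)"
  by (induction T) auto

subsection \<open>Counting binary trees by left depth\<close>

definition forests :: "nat \<Rightarrow> nat \<Rightarrow> unit tree list set" where
  "forests n s = {ts. length ts = s \<and> sum_list (map size ts) = n}"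

text \<open>
  The list is the stack of a depth-first traversal with its top at the head: a vertex of left depth
  \<open>j\<close> in a tree with \<open>i - 1\<close> trees below it in the stack is visited when the stack has height
  \<open>i + j\<close>. So \<open>confined L\<close> says that the lattice path recording the stack height stays below \<open>L\<close>.
\<close>

fun confined :: "nat \<Rightarrow> 'a tree list \<Rightarrow> bool" where
  "confined L [] = True"
| "confined L (t # ts) = (Suc (length ts) + left_depth t < L \<and> confined L ts)"

text \<open>Inverse to the step of the traversal that replaces a vertex on top of the stack by its children.\<close>

fun graft :: "unit tree list \<Rightarrow> unit tree list" where
  "graft (l # r # ts) = Node l () r # ts"
| "graft ts = ts"

text \<open>The maximum in the left depth of a node splits into a condition on \<open>l\<close>,
  which sits one place higher in the stack, and one on \<open>r\<close>, which takes over the height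
  of the node.\<close>

lemma confined_graft: "2 \<le> length ts \<Longrightarrow> confined L (graft ts) = confined L ts"
  by (cases ts rule: graft.cases) auto

lemma forests_0_0: "forests 0 0 = {[]}"
  by (auto simp: forests_def)

lemma forests_Suc_0: "forests (Suc n) 0 = {}"
  by (auto simp: forests_def)

lemma forests_0_Suc: "forests 0 (Suc s) = Cons Leaf ` forests 0 s"
  by (auto simp: forests_def length_Suc_conv)

text \<open>First step of the traversal: an empty tree on top is popped, or a vertex on top is
  replaced by its two children.\<close>

lemma forests_Suc_Suc:
  "forests (Suc n) (Suc s) = Cons Leaf ` forests (Suc n) s \<union> graft ` forests n (Suc (Suc s))"
    (is "?L = ?R")
proof
  show "?L \<subseteq> ?R"
  proof
    fix ts assume "ts \<in> ?L"
    then obtain t us where ts: "ts = t # us" "length us = s" "size t + sum_list (map size us) = Suc n"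
      by (auto simp: forests_def length_Suc_conv)
    show "ts \<in> ?R"
    proof (cases t)
      case Leaf
      then show ?thesis using ts by (auto simp: forests_def)
    next
      case (Node l a r)
      then have "ts = graft (l # r # us)" "l # r # us \<in> forests n (Suc (Suc s))"
        using ts by (auto simp: forests_def)
      then show ?thesis by blast
    qed
  qed
  show "?R \<subseteq> ?L"
    by (auto simp: forests_def length_Suc_conv)
qed

lemma inj_on_graft: "inj_on graft (forests n (Suc (Suc s)))"
proof (rule inj_onI)
  fix ts us assume "ts \<in> forests n (Suc (Suc s))" "us \<in> forests n (Suc (Suc s))" "graft ts = graft us"
  then show "ts = us"
    by (cases ts rule: graft.cases; cases us rule: graft.cases) (simp_all add: forests_def)
qed

lemma finite_forests [simp]: "finite (forests n s)"
proof (induction "2 * n + s" arbitrary: n s rule: less_induct)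
  \<comment> \<open>A forest of \<open>s\<close> trees with \<open>n\<close> vertices has
    \<open>n + s\<close> absent children, so \<open>2 * n + s\<close> is the number of traversal
    steps; both branches of the recurrence lower it by one.\<close>
  case less
  show ?case
  proof (cases n; cases s)
    fix m r assume "n = Suc m" "s = Suc r"
    then show ?thesis using less by (simp add: forests_Suc_Suc)
  next
    fix r assume "n = 0" "s = Suc r"
    then show ?thesis using less by (simp add: forests_0_Suc)
  qed (simp_all add: forests_0_0 forests_Suc_0)
qed

text \<open>The predicate is left free so that one recurrence serves both the total count and the
  count of forests that cross the barrier.\<close>

lemma card_forests_rec:
  "card {ts \<in> forests (Suc n) (Suc s). Q ts} =
     card {ts \<in> forests (Suc n) s. Q (Leaf # ts)} + card {ts \<in> forests n (Suc (Suc s)). Q (graft ts)}"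
proof -
  let ?A = "{ts \<in> forests (Suc n) s. Q (Leaf # ts)}"
  let ?B = "{ts \<in> forests n (Suc (Suc s)). Q (graft ts)}"
  have "{ts \<in> forests (Suc n) (Suc s). Q ts} = Cons Leaf ` ?A \<union> graft ` ?B"
    by (auto simp: forests_Suc_Suc)
  moreover have "Cons Leaf ` ?A \<inter> graft ` ?B = {}"
    by (auto simp: forests_def length_Suc_conv)
  moreover have "card (graft ` ?B) = card ?B"
    by (rule card_image) (rule inj_on_subset[OF inj_on_graft], auto)
  ultimately show ?thesis by (simp add: card_Un_disjoint card_image)
qed

section \<open>Ballot numbers and the total number of forests\<close>

text \<open>By the cycle lemma, the number of lattice paths from height \<open>s\<close> with
  \<open>n\<close> up steps that first reach 0 at step \<open>2 * n + s\<close>; Catalan numbers for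
  \<open>s = 1\<close>.\<close>

definition ballot :: "nat \<Rightarrow> nat \<Rightarrow> real" where
  "ballot n s = real s / real (2 * n + s) * real (2 * n + s choose n)"

lemma ballot_0 [simp]: "0 < s \<Longrightarrow> ballot 0 s = 1" "ballot n 0 = 0"
  by (simp_all add: ballot_def)

lemma ballot_nonneg: "ballot n s \<ge> 0"
  by (simp add: ballot_def)

text \<open>The ratio of neighbouring binomials, over the reals to avoid truncated subtraction; both
  sides vanish for \<open>n > N\<close>.\<close>

lemma binomial_Suc_real:
  "real (Suc n) * real (N choose Suc n) = (real N - real n) * real (N choose n)"
proof (cases "n \<le> N")
  case True
  have "Suc n * (N choose Suc n) = (N - n) * (N choose n)"
    using binomial_absorb_comp[of N n] binomial_absorption[of n "N"] by (cases N) (auto simp: Suc_times_binomial)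
  then have "real (Suc n * (N choose Suc n)) = real ((N - n) * (N choose n))" by simp
  then show ?thesis using True by (simp only: of_nat_mult of_nat_diff)
qed (simp add: binomial_eq_0)

lemma ballot_rec: "ballot (Suc n) (Suc s) = ballot (Suc n) s + ballot n (Suc (Suc s))"
proof -
  \<comment> \<open>\<open>N\<close> is the number of steps left after the first one; all three
    ballot numbers are rational multiples of \<open>N choose n\<close>.\<close>
  define N where "N = 2 * n + s + 2"
  define c where "c = real (N choose n)"
  have N: "real N = 2 * real n + real s + 2" "real N > 0" by (simp_all add: N_def)
  have 1: "real (N choose Suc n) = (real N - real n) * c / (real n + 1)"
    using binomial_Suc_real[of n N] by (simp add: c_def field_simps)
  have 2: "real (Suc N choose Suc n) = (real N + 1) * c / (real n + 1)"
    using Suc_times_binomial[of n N] by (simp add: c_def field_simps flip: of_nat_mult of_nat_Suc of_nat_add)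
  have "ballot (Suc n) (Suc s) = (real s + 1) / (real N + 1) * real (Suc N choose Suc n)"
    by (simp add: ballot_def N_def)
  also have "\<dots> = (real s + 1) * c / (real n + 1)"
    using N unfolding 2 by (simp add: divide_simps)
  also have "\<dots> = real s / real N * ((real N - real n) * c / (real n + 1)) + (real s + 2) / real N * c"
    using N(2) by (simp add: divide_simps) (simp add: N(1) algebra_simps)
  also have "\<dots> = ballot (Suc n) s + ballot n (Suc (Suc s))"
    unfolding 1[symmetric] by (simp add: ballot_def N_def c_def)
  finally show ?thesis .
qed

text \<open>Both sides satisfy the same recurrence and boundary values. The case
  \<open>n = s = 0\<close> is excluded because the empty list counts 1 while
  \<open>ballot 0 0 = 0\<close>.\<close>

lemma card_forests:
  assumes "n + s > 0"
  shows "real (card (forests n s)) = ballot n s"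
  using assms
proof (induction "2 * n + s" arbitrary: n s rule: less_induct)
  case less
  show ?case
  proof (cases n; cases s)
    fix m r assume ns: "n = Suc m" "s = Suc r"
    have "card (forests n s) = card (forests (Suc m) r) + card (forests m (Suc (Suc r)))"
      using card_forests_rec[of m r "\<lambda>_. True"] ns by simp
    then show ?thesis using less ns by (simp add: ballot_rec)
  next
    fix r assume ns: "n = 0" "s = Suc r"
    then have "card (forests n s) = card (forests 0 r)"
      by (simp add: forests_0_Suc card_image)
    then show ?thesis using less(1)[of 0 r] ns by (cases r) (auto simp: forests_0_0)
  qed (use less in \<open>simp_all add: forests_Suc_0\<close>)
qed

section \<open>Reflection at the barrier\<close>

text \<open>
  The first two terms of the alternating sum that the reflection principle gives for the number of
  paths hitting the barrier \<open>L\<close>. The first term alone also solves the recurrence and dominates the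
  count, but is too large by a factor of order \<open>n / L\<close>; the second makes the solution vanish at
  \<open>s = 0\<close>. The price is a value at the barrier that is too small, by a factor of at most \<open>2\<close> as soon
  as \<open>5 * n \<le> L\<^sup>2\<close>.
\<close>

definition reflected :: "nat \<Rightarrow> nat \<Rightarrow> nat \<Rightarrow> real" where
  "reflected L n s = (if L \<le> n + s then ballot (n + s - L) (2 * L - s) else 0)
     - (if L \<le> n then ballot (n - L) (2 * L + s) else 0)"

text \<open>Each of the two terms solves the recurrence by itself. Shifting \<open>s\<close> by
  \<open>2 * L\<close> preserves the recurrence, and reflecting \<open>s\<close> to
  \<open>2 * L - s\<close> merely exchanges the up step with the down step.\<close>

lemma reflected_rec:
  assumes "Suc s < L"
  shows "reflected L (Suc n) (Suc s) = reflected L (Suc n) s + reflected L n (Suc (Suc s))"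
proof -
  define f where "f n s = (if L \<le> n + s then ballot (n + s - L) (2 * L - s) else 0)" for n s
  define g where "g n s = (if L \<le> n then ballot (n - L) (2 * L + s) else 0)" for n s
  have f: "f (Suc n) (Suc s) = f (Suc n) s + f n (Suc (Suc s))"
  proof -
    consider "n + s + 2 < L" | "n + s + 2 = L" | "n + s + 2 > L" by linarith
    then show ?thesis
    proof cases
      \<comment> \<open>The edge of the support: the left side and the up-step term are both
        \<open>ballot 0 _ = 1\<close>, the down-step term is 0.\<close>
      case 2
      then show ?thesis by (auto simp: f_def)
    next
      case 3
      define k where "k = n + s + 1 - L"
      define j where "j = 2 * L - Suc (Suc s)"
      have j: "2 * L - Suc s = Suc j" "2 * L - s = Suc (Suc j)" "2 * L - Suc (Suc s) = j"
        using assms by (auto simp: j_def)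
      have k: "Suc n + Suc s - L = Suc k" "Suc n + s - L = k" "n + Suc (Suc s) - L = Suc k"
        "L \<le> Suc n + Suc s" "L \<le> Suc n + s" "L \<le> n + Suc (Suc s)" using 3 by (auto simp: k_def)
      have "f (Suc n) (Suc s) = ballot (Suc k) (Suc j)" "f (Suc n) s = ballot k (Suc (Suc j))"
        "f n (Suc (Suc s)) = ballot (Suc k) j"
        by (simp_all only: f_def j k if_True)
      then show ?thesis using ballot_rec[of k j] by simp
    qed (simp add: f_def)
  qed
  have g: "g (Suc n) (Suc s) = g (Suc n) s + g n (Suc (Suc s))"
  proof -
    consider "Suc n < L" | "Suc n = L" | "n \<ge> L" by linarith
    then show ?thesis
    proof cases
      case 3
      then show ?thesis by (simp add: g_def Suc_diff_le ballot_rec)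
    qed (auto simp: g_def)
  qed
  show ?thesis using f g unfolding reflected_def f_def g_def by simp
qed

text \<open>Moving the lower index from \<open>n - L\<close> to \<open>n\<close> takes
  \<open>L\<close> steps, each multiplying the binomial by at least \<open>q = 1 + L / n\<close>;
  Bernoulli's inequality bounds \<open>q ^ L\<close> from below.\<close>

lemma binomial_ratio_bernoulli:
  assumes "L \<le> n" "n > 0"
  shows "(1 + real L * real L / real n) * real (2 * n + L choose (n - L)) \<le> real (2 * n + L choose n)"
proof -
  define q where "q = 1 + real L / real n"
  have "q ^ k * real (2 * n + L choose (n - k)) \<le> real (2 * n + L choose n)" if "k \<le> n" for k
    using that
  proof (induction k)
    case (Suc k)
    then obtain m where m: "n - k = Suc m" "n - Suc k = m" by (metis Suc_diff_Suc Suc_le_lessD)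
    have n: "real n = real m + real k + 1" using m Suc.prems by linarith
    let ?a = "real (2 * n + L choose m)" and ?b = "real (2 * n + L choose Suc m)"
    have "(real m + 1) * ?b = (real n + real L + (real k + 1)) * ?a"
      using binomial_Suc_real[of m "2 * n + L"] n by (simp add: algebra_simps)
    then have b: "?b = (real n + real L + (real k + 1)) / (real m + 1) * ?a" by (simp add: field_simps)
    have "q \<le> (real n + real L + (real k + 1)) / (real m + 1)"
    proof -
      have "q = (real n + real L) / real n" using assms by (simp add: q_def field_simps)
      also have "\<dots> \<le> (real n + real L + (real k + 1)) / (real m + 1)"
        by (rule frac_le) (use n in auto)
      finally show ?thesis .
    qed
    then have "q * ?a \<le> ?b" unfolding b by (rule mult_right_mono) simp
    moreover have "q \<ge> 0" by (simp add: q_def)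
    ultimately have "q ^ k * (q * ?a) \<le> q ^ k * ?b" by (intro mult_left_mono) auto
    then show ?case using Suc m by (simp add: mult_ac)
  qed simp
  from this[OF assms(1)]
  have *: "q ^ L * real (2 * n + L choose (n - L)) \<le> real (2 * n + L choose n)" .
  have "1 + real L * real L / real n \<le> q ^ L"
    using Bernoulli_inequality[of "real L / real n" L] order_trans[of "-1" 0 "real L / real n"]
    by (simp add: q_def)
  then have "(1 + real L * real L / real n) * real (2 * n + L choose (n - L))
      \<le> q ^ L * real (2 * n + L choose (n - L))" by (intro mult_right_mono) auto
  with * show ?thesis by linarith
qed

text \<open>At \<open>s = L\<close> the two terms are \<open>ballot n L\<close> and
  \<open>ballot (n - L) (3 * L)\<close>, with equal denominators and prefactors in ratio 3. For the
  second to be at most half of the first, the binomials must have ratio \<open>6 = 1 + 5\<close>,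
  whence \<open>5 * n \<le> L\<^sup>2\<close>.\<close>

lemma ballot_le_reflected:
  assumes "L > 0" "5 * n \<le> L\<^sup>2"
  shows "ballot n L \<le> 2 * reflected L n L"
proof (cases "L \<le> n")
  case True
  then have n: "n > 0" using assms by auto
  have "5 * real n \<le> real L * real L"
    using of_nat_mono[OF assms(2), where ?'a = real] by (simp add: power2_eq_square)
  then have "6 \<le> 1 + real L * real L / real n" using n by (simp add: field_simps)
  then have "6 * real (2 * n + L choose (n - L)) \<le>
      (1 + real L * real L / real n) * real (2 * n + L choose (n - L))"
    by (rule mult_right_mono) simp
  also have "\<dots> \<le> real (2 * n + L choose n)" by (rule binomial_ratio_bernoulli[OF True n])
  finally have *: "6 * real (2 * n + L choose (n - L)) \<le> real (2 * n + L choose n)" .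
  have "2 * (n - L) + 3 * L = 2 * n + L" using True by simp
  then have "2 * ballot (n - L) (3 * L) = real L / real (2 * n + L) * (6 * real (2 * n + L choose (n - L)))"
    unfolding ballot_def by (simp only:) simp
  also have "\<dots> \<le> ballot n L" unfolding ballot_def
    by (rule mult_left_mono[OF *]) simp
  finally have "2 * ballot (n - L) (3 * L) \<le> ballot n L" .
  moreover have "n + L - L = n" "2 * L - L = L" "2 * L + L = 3 * L" by simp_all
  ultimately show ?thesis using True by (simp add: reflected_def)
qed (use ballot_nonneg in \<open>auto simp: reflected_def\<close>)

text \<open>A discrete comparison principle: both sides satisfy the same recurrence for
  \<open>0 < s < L\<close>, so the inequality only has to be checked at \<open>s = L\<close>, at
  \<open>s = 0\<close> and at \<open>n = 0\<close>, where below the barrier both sides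
  vanish.\<close>

lemma card_not_confined_le:
  assumes "L > 0" "5 * n \<le> L\<^sup>2" "s \<le> L"
  shows "real (card {ts \<in> forests n s. \<not> confined L ts}) \<le> 2 * reflected L n s"
  using assms(2,3)
proof (induction "2 * n + s" arbitrary: n s rule: less_induct)
  case less
  consider "s = L" | "s = 0" | r where "s = Suc r" "Suc r < L"
    using less.prems by (cases s) (auto simp: le_less)
  then show ?case
  proof cases
    case 1
    have "real (card {ts \<in> forests n s. \<not> confined L ts}) \<le> real (card (forests n s))"
      by (simp add: card_mono)
    also have "\<dots> = ballot n L" using 1 assms(1) by (simp add: card_forests)
    also have "\<dots> \<le> 2 * reflected L n s"
      using ballot_le_reflected[OF assms(1) less.prems(1)] 1 by simp
    finally show ?thesis .
  next
    case 2
    have e: "{ts \<in> forests n 0. \<not> confined L ts} = {}" by (auto simp: forests_def)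
    show ?thesis unfolding 2 e by (simp add: reflected_def)
  next
    case (3 r)
    show ?thesis
    proof (cases n)
      case 0
      have "ts \<notin> forests 0 s" if "\<not> confined L ts" for ts
        using that 3
      proof (induction ts arbitrary: s r)
        case (Cons t ts)
        then show ?case by (cases ts) (auto simp: forests_def)
      qed simp
      then have "{ts \<in> forests n s. \<not> confined L ts} = {}" using 0 by auto
      then show ?thesis using 0 3 by (simp add: reflected_def)
    next
      case (Suc m)
      \<comment> \<open>Neither traversal step affects confinement here: the height
        \<open>Suc r\<close> of the larger stack is still below \<open>L\<close>.\<close>
      have "{ts \<in> forests (Suc m) r. \<not> confined L (Leaf # ts)} = {ts \<in> forests (Suc m) r. \<not> confined L ts}"
        using 3 by (auto simp: forests_def)
      moreover have "{ts \<in> forests m (Suc (Suc r)). \<not> confined L (graft ts)}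
          = {ts \<in> forests m (Suc (Suc r)). \<not> confined L ts}"
        by (auto simp: forests_def confined_graft)
      ultimately have "card {ts \<in> forests n s. \<not> confined L ts} =
          card {ts \<in> forests (Suc m) r. \<not> confined L ts}
          + card {ts \<in> forests m (Suc (Suc r)). \<not> confined L ts}"
        using card_forests_rec[of m r "\<lambda>ts. \<not> confined L ts"] Suc 3 by simp
      moreover have "real (card {ts \<in> forests (Suc m) r. \<not> confined L ts}) \<le> 2 * reflected L (Suc m) r"
        by (rule less.hyps) (use Suc 3 less.prems in auto)
      moreover have "real (card {ts \<in> forests m (Suc (Suc r)). \<not> confined L ts})
          \<le> 2 * reflected L m (Suc (Suc r))"
        by (rule less.hyps) (use Suc 3 less.prems in auto)
      ultimately show ?thesis using reflected_rec[of r L m] Suc 3 by simp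
    qed
  qed
qed

section \<open>Gaussian estimate for the reflected count of single trees\<close>

text \<open>The step from \<open>L\<close> to \<open>L + 1\<close> multiplies the binomial by at
  most \<open>1 - p \<le> exp (- p)\<close> with \<open>p = (L + 1) / (n + 1)\<close>, and these
  \<open>p\<close> add up to the exponent.\<close>

lemma binomial_gaussian_bound:
  assumes "L \<le> n"
  shows "real (2 * n + 1 choose (n - L)) \<le>
    real (2 * n + 1 choose n) * exp (- (real L * (real L + 1)) / (2 * real n + 2))"
  using assms
proof (induction L)
  case (Suc L)
  then obtain m where m: "n - L = Suc m" "n - Suc L = m" by (metis Suc_diff_Suc Suc_le_lessD)
  have n: "real n = real m + real L + 1" using m Suc.prems by linarith
  define p where "p = 2 * (real L + 1) / (2 * real n + 2)"
  let ?a = "real (2 * n + 1 choose m)" and ?b = "real (2 * n + 1 choose Suc m)"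
  have "(real m + 1) * ?b = (real n + real L + 2) * ?a"
    using binomial_Suc_real[of m "2 * n + 1"] n by (simp add: algebra_simps)
  then have "?a = (real m + 1) / (real n + real L + 2) * ?b" by (simp add: field_simps)
  also have "(real m + 1) / (real n + real L + 2) = 1 - 2 * (real L + 1) / (real n + real L + 2)"
    using n by (simp add: field_simps)
  also have "1 - 2 * (real L + 1) / (real n + real L + 2) \<le> 1 - p"
    unfolding p_def using n by (intro diff_left_mono divide_left_mono) auto
  also have "1 - p \<le> exp (- p)" using exp_ge_add_one_self[of "- p"] by simp
  finally have "?a \<le> exp (- p) * ?b" by (simp add: mult_right_mono)
  also have "\<dots> \<le> exp (- p) *
      (real (2 * n + 1 choose n) * exp (- (real L * (real L + 1)) / (2 * real n + 2)))"
    using Suc m by (intro mult_left_mono) auto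
  also have "\<dots> = real (2 * n + 1 choose n) *
      exp (- p + - (real L * (real L + 1)) / (2 * real n + 2))"
    by (subst exp_add) (simp only: mult_ac)
  also have "- p + - (real L * (real L + 1)) / (2 * real n + 2) =
      - (real (Suc L) * (real (Suc L) + 1)) / (2 * real n + 2)"
    unfolding p_def by (simp add: divide_simps) (simp add: algebra_simps)
  finally show ?case using m by simp
qed simp

text \<open>The two terms nearly cancel, which leaves a prefactor of order
  \<open>h\<^sup>2 / n\<close> instead of \<open>h\<close>. Being a function of the exponent, it can
  later be absorbed into the exponential.\<close>

lemma reflected_1_le:
  "reflected (Suc h) n 1 \<le> 4 * (real h + 1)\<^sup>2 / (real n + 1) *
     exp (- (real h * (real h + 1)) / (2 * real n + 2)) * ballot n 1"
proof (cases "h \<le> n")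
  case False
  then show ?thesis using ballot_nonneg[of n 1] by (simp add: reflected_def)
next
  case True
  define E where "E = exp (- (real h * (real h + 1)) / (2 * real n + 2))"
  define c where "c = real (2 * n + 1 choose (n - h))"
  consider "n = h" | "h < n" using True by linarith
  then have "reflected (Suc h) n 1 \<le> 4 * (real h + 1)\<^sup>2 / (real n + 1) * c / (2 * real n + 1)"
  proof cases
    case 1
    \<comment> \<open>Only the first term is present, and it is \<open>ballot 0 _\<close>.\<close>
    have "reflected (Suc h) n 1 = 1" using 1 by (simp add: reflected_def)
    also have "1 \<le> 4 * (real n + 1)\<^sup>2 / (real n + 1) / (2 * real n + 1)"
      by (simp add: divide_simps power2_eq_square)
    finally show ?thesis using 1 by (simp add: c_def)
  next
    case 2
    then obtain m where m: "n = Suc (m + h)" using less_imp_Suc_add by (metis add.commute)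
    let ?a = "real (2 * n + 1 choose m)"
    have idx: "n - h = Suc m" "n - Suc h = m" "n + 1 - Suc h = Suc m" using m by auto
    have "(real m + 1) * c = (real m + 2 * real h + 3) * ?a"
      using binomial_Suc_real[of m "2 * n + 1"] m by (simp add: c_def idx algebra_simps)
    then have a: "?a = (real m + 1) * c / (real m + 2 * real h + 3)" by (simp add: field_simps)
    have "2 * Suc h - 1 = 2 * h + 1" "2 * Suc m + (2 * h + 1) = 2 * n + 1" "2 * m + (2 * Suc h + 1) = 2 * n + 1"
      using m by auto
    then have "reflected (Suc h) n 1 =
        (2 * real h + 1) / (2 * real n + 1) * c - (2 * real h + 3) / (2 * real n + 1) * ?a"
      using 2 unfolding reflected_def ballot_def idx c_def
      by (simp only:) (simp add: add.commute del: binomial_Suc_Suc)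
    also have "\<dots> = ((2 * real h + 1) - (2 * real h + 3) * (real m + 1) / (real m + 2 * real h + 3)) * c
        / (2 * real n + 1)"
      unfolding a by (simp add: divide_simps) (simp add: algebra_simps)
    also have "(2 * real h + 1) - (2 * real h + 3) * (real m + 1) / (real m + 2 * real h + 3)
        \<le> 4 * (real h + 1)\<^sup>2 / (real n + 1)"
    proof -
      have "(2 * real h + 1) - (2 * real h + 3) * (real m + 1) / (real m + 2 * real h + 3)
          = ((2 * real h + 1) * (real m + 2 * real h + 3) - (2 * real h + 3) * (real m + 1))
            / (real m + 2 * real h + 3)"
        by (simp add: divide_simps)
      also have "\<dots> \<le> 4 * (real h + 1)\<^sup>2 / (real m + 2 * real h + 3)"
        by (rule divide_right_mono) (auto simp: power2_eq_square algebra_simps)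
      also have "\<dots> \<le> 4 * (real h + 1)\<^sup>2 / (real n + 1)"
        by (rule divide_left_mono) (auto simp: m)
      finally show ?thesis .
    qed
    finally show ?thesis by (simp add: c_def mult_right_mono divide_right_mono)
  qed
  also have "\<dots> \<le> 4 * (real h + 1)\<^sup>2 / (real n + 1) * E * ballot n 1"
  proof -
    have "c \<le> real (2 * n + 1 choose n) * E"
      using binomial_gaussian_bound[OF True] by (simp only: c_def E_def)
    then have "4 * (real h + 1)\<^sup>2 / (real n + 1) * c / (2 * real n + 1) \<le>
        4 * (real h + 1)\<^sup>2 / (real n + 1) * (real (2 * n + 1 choose n) * E) / (2 * real n + 1)"
      by (intro divide_right_mono mult_left_mono) auto
    then show ?thesis by (simp add: ballot_def ac_simps)
  qed
  finally show ?thesis by (simp only: E_def)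
qed

section \<open>Tails of left depth and height for binary trees\<close>

text \<open>A single tree is a stack of height 1, so it reaches the barrier \<open>Suc h\<close>
  exactly when its left depth is at least \<open>h\<close>.\<close>

lemma card_left_depth_ge:
  assumes "5 * n \<le> (Suc h)\<^sup>2"
  shows "real (card {T :: unit tree. size T = n \<and> h \<le> left_depth T}) \<le>
    2 * reflected (Suc h) n 1"
proof -
  let ?A = "{T :: unit tree. size T = n \<and> h \<le> left_depth T}"
  have "card ?A = card ((\<lambda>T. [T]) ` ?A)"
    by (rule card_image[symmetric]) (auto intro: inj_onI)
  also have "(\<lambda>T. [T]) ` ?A = {ts \<in> forests n 1. \<not> confined (Suc h) ts}"
    by (auto simp: forests_def length_Suc_conv)
  finally show ?thesis using card_not_confined_le[of "Suc h" n 1] assms by simp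
qed

lemma card_trees_size: "real (card {T :: unit tree. size T = n}) = ballot n 1"
proof -
  let ?A = "{T :: unit tree. size T = n}"
  have "card ?A = card ((\<lambda>T. [T]) ` ?A)"
    by (rule card_image[symmetric]) (auto intro: inj_onI)
  also have "(\<lambda>T. [T]) ` ?A = forests n 1"
    by (auto simp: forests_def length_Suc_conv)
  finally show ?thesis using card_forests[of n 1] by simp
qed

lemma finite_trees_size [simp]: "finite {T :: unit tree. size T = n}"
  by (rule finite_subset[OF _ finite_trees_bounded[of UNIV n]]) auto

lemma left_depth_tail:
  assumes "5 * n \<le> (Suc h)\<^sup>2" "h \<ge> 1"
  shows "real (card {T :: unit tree. size T = n \<and> h \<le> left_depth T}) \<le>
    64 * exp (- (real h)\<^sup>2 / (8 * (real n + 1))) * real (card {T :: unit tree. size T = n})"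
proof -
  define y where "y = (real h + 1)\<^sup>2 / (real n + 1)"
  have y: "y \<ge> 0" by (simp add: y_def)
  have "2 * reflected (Suc h) n 1 \<le>
      8 * y * exp (- (real h * (real h + 1)) / (2 * real n + 2)) * ballot n 1"
    using reflected_1_le[of h n] by (simp add: y_def)
  also have "\<dots> \<le> 8 * y * exp (- (y / 4)) * ballot n 1"
  proof -
    \<comment> \<open>\<open>h \<ge> 1\<close> gives \<open>h + 1 \<le> 2 * h\<close>, so the
      exponent can be written in terms of \<open>y\<close> as well.\<close>
    have "(real h + 1)\<^sup>2 / 4 \<le> real h * (real h + 1) / 2"
    proof -
      have "(real h + 1) * (real h + 1) \<le> (2 * real h) * (real h + 1)"
        using assms(2) by (intro mult_right_mono) auto
      then show ?thesis by (simp add: power2_eq_square)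
    qed
    then have "(real h + 1)\<^sup>2 / 4 / (real n + 1) \<le> real h * (real h + 1) / 2 / (real n + 1)"
      by (intro divide_right_mono) auto
    then have "- (real h * (real h + 1)) / (2 * real n + 2) \<le> - (y / 4)"
      by (simp add: y_def field_simps)
    then show ?thesis using y ballot_nonneg by (intro mult_right_mono mult_left_mono) auto
  qed
  also have "\<dots> \<le> 64 * exp (- (y / 8)) * ballot n 1"
  proof -
    \<comment> \<open>Half of the exponent \<open>y / 4\<close> is spent on the polynomial factor
      \<open>y\<close>.\<close>
    have "y \<le> 8 * exp (y / 8)" using exp_ge_add_one_self[of "y / 8"] by linarith
    then have "8 * y * exp (- (y / 4)) \<le> 8 * (8 * exp (y / 8)) * exp (- (y / 4))"
      by (intro mult_right_mono) auto
    also have "\<dots> = 64 * exp (- (y / 8))" by (simp flip: exp_add)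
    finally show ?thesis using ballot_nonneg by (intro mult_right_mono) auto
  qed
  also have "\<dots> \<le> 64 * exp (- (real h)\<^sup>2 / (8 * (real n + 1))) * ballot n 1"
  proof -
    have "(real h)\<^sup>2 / (real n + 1) \<le> y" unfolding y_def
      by (intro divide_right_mono power_mono) auto
    then have "- (y / 8) \<le> - (real h)\<^sup>2 / (8 * (real n + 1))" by (simp add: field_simps)
    then show ?thesis using ballot_nonneg by (intro mult_right_mono mult_left_mono) auto
  qed
  finally show ?thesis using card_left_depth_ge[OF assms(1)] unfolding card_trees_size by linarith
qed

lemma binary_tree_height_tail:
  assumes "x > 0" "n > 0"
  shows "real (card {T :: unit tree. size T = n \<and> x \<le> real (height T)}) \<le>
    128 * exp (- x\<^sup>2 / (64 * real n)) * real (card {T :: unit tree. size T = n})"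
proof (cases "x\<^sup>2 \<le> 20 * real n")
  \<comment> \<open>With \<open>h\<close> about \<open>x / 2\<close>, the condition
    \<open>5 * n \<le> h\<^sup>2\<close> is available once \<open>x\<^sup>2 > 20 * n\<close>; below
    that the claimed factor exceeds 1.\<close>
  case True
  have "x\<^sup>2 / (64 * real n) \<le> 1" using True assms by (simp add: field_simps)
  then have "exp (-1) \<le> exp (- x\<^sup>2 / (64 * real n))" by simp
  moreover have "exp (-1 :: real) \<ge> 1 / 3" using exp_le by (simp add: exp_minus field_simps)
  ultimately have "1 \<le> 128 * exp (- x\<^sup>2 / (64 * real n))" by linarith
  then have "1 * real (card {T :: unit tree. size T = n}) \<le>
      128 * exp (- x\<^sup>2 / (64 * real n)) * real (card {T :: unit tree. size T = n})"
    by (rule mult_right_mono) simp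
  moreover have "card {T :: unit tree. size T = n \<and> x \<le> real (height T)} \<le> card {T :: unit tree. size T = n}"
    by (rule card_mono) auto
  ultimately show ?thesis by linarith
next
  case False
  define h where "h = nat \<lceil>x / 2\<rceil>"
  have h: "x / 2 \<le> real h" "h \<ge> 1" using assms(1) unfolding h_def by linarith+
  have h2: "x\<^sup>2 / 4 \<le> (real h)\<^sup>2"
    using power_mono[OF h(1), of 2] assms(1) by (simp add: power_divide)
  have "real (5 * n) \<le> real (h\<^sup>2)" using False h2 by simp
  then have "5 * n \<le> h\<^sup>2" by (simp only: of_nat_le_iff)
  also have "h\<^sup>2 \<le> (Suc h)\<^sup>2" by (rule power_mono) auto
  finally have n: "5 * n \<le> (Suc h)\<^sup>2" .
  let ?A = "{T :: unit tree. size T = n \<and> h \<le> left_depth T}"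
  have fin: "finite ?A" by (rule finite_subset[OF _ finite_trees_size[of n]]) auto
  \<comment> \<open>One of the two left depths is at least half the height. Mirroring preserves the
    size, so the count at most doubles and 64 becomes 128.\<close>
  have "{T :: unit tree. size T = n \<and> x \<le> real (height T)} \<subseteq> ?A \<union> mirror ` ?A"
  proof
    fix T :: "unit tree" assume T: "T \<in> {T. size T = n \<and> x \<le> real (height T)}"
    have "h \<le> left_depth T \<or> h \<le> left_depth (mirror T)"
    proof (rule ccontr)
      assume "\<not> ?thesis"
      then have "real (left_depth T) < x / 2" "real (left_depth (mirror T)) < x / 2"
        unfolding h_def by linarith+
      then show False using height_le_left_depths[of T] T by simp
    qed
    then show "T \<in> ?A \<union> mirror ` ?A"
      using T by (auto intro!: image_eqI[of T mirror "mirror T"])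
  qed
  then have "card {T :: unit tree. size T = n \<and> x \<le> real (height T)} \<le> card (?A \<union> mirror ` ?A)"
    by (rule card_mono[rotated]) (use fin in auto)
  also have "\<dots> \<le> card ?A + card ?A"
    using card_Un_le[of ?A "mirror ` ?A"] card_image_le[OF fin, of mirror] by linarith
  finally have "real (card {T :: unit tree. size T = n \<and> x \<le> real (height T)}) \<le> 2 * real (card ?A)"
    by linarith
  also have "\<dots> \<le> 128 * exp (- (real h)\<^sup>2 / (8 * (real n + 1))) * real (card {T :: unit tree. size T = n})"
    using left_depth_tail[OF n h(2)] by linarith
  also have "\<dots> \<le> 128 * exp (- x\<^sup>2 / (64 * real n)) * real (card {T :: unit tree. size T = n})"
  proof -
    \<comment> \<open>The factor 4 comes from \<open>h \<ge> x / 2\<close>, and 16 from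
      \<open>n + 1 \<le> 2 * n\<close>.\<close>
    have "x\<^sup>2 / (64 * real n) = (x\<^sup>2 / 4) / (16 * real n)" by simp
    also have "\<dots> \<le> (real h)\<^sup>2 / (8 * (real n + 1))"
      using h2 assms(2) by (intro frac_le) auto
    finally show ?thesis by (intro mult_right_mono mult_left_mono) auto
  qed
  finally show ?thesis .
qed

subsection \<open>Heights of multi-level trees\<close>

lemma walk_lift:
  assumes "label_at T p = Some t" "(u, v) \<in> adjacency t ^^ k"
  shows "(p # u, p # v) \<in> adjacency (Level T) ^^ k"
  using assms(2)
proof (induction k arbitrary: v)
  case (Suc k)
  then obtain w where w: "(u, w) \<in> adjacency t ^^ k" "(w, v) \<in> adjacency t" by auto
  then have "(p # w, p # v) \<in> adjacency (Level T)"
    using assms(1) by (auto simp: adjacency_def intro: is_child.intros)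
  then show ?case using Suc.IH[OF w(1)] by auto
qed simp

lemma walk_first_level:
  assumes "p \<in> positions T"
    and "\<And>p b. p \<in> positions T \<Longrightarrow> p @ [b] \<in> positions T \<Longrightarrow> is_child t [p] [p @ [b]]"
  shows "(tree_root, [p]) \<in> adjacency t ^^ length p"
  using assms(1)
proof (induction p rule: rev_induct)
  case (snoc b p)
  have p: "p \<in> positions T" using snoc.prems positions_prefix by blast
  then have "([p], [p @ [b]]) \<in> adjacency t"
    using assms(2) snoc.prems by (auto simp: adjacency_def)
  then show ?case using snoc.IH[OF p] by auto
qed (simp add: tree_root_def)

lemma length_position: "p \<in> positions T \<Longrightarrow> length p < height T"
proof (induction T arbitrary: p)
  case (Node l a r)
  then show ?case by (fastforce simp: positions_Node less_max_iff_disj)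
qed simp

lemma graph_dist_le: "(u, v) \<in> adjacency t ^^ k \<Longrightarrow> graph_dist t u v \<le> k"
  unfolding graph_dist_def by (rule Least_le)

lemma walk_graph_dist:
  assumes "is_vertex t v"
  shows "(tree_root, v) \<in> adjacency t ^^ graph_dist t tree_root v"
  using reachable_from_root[OF assms] unfolding graph_dist_def rtrancl_power by (rule LeastI_ex)

lemma graph_dist_le_tree_height: "is_vertex t v \<Longrightarrow> graph_dist t tree_root v \<le> tree_height t"
  unfolding tree_height_def by (rule Max_ge) (auto simp: vertices_def[symmetric], simp add: vertices_def)

lemma tree_height_le:
  assumes "vertices t \<noteq> {}" "\<And>v. is_vertex t v \<Longrightarrow> graph_dist t tree_root v \<le> m"
  shows "tree_height t \<le> m"
  unfolding tree_height_def using assms by (subst Max_le_iff) (auto, simp add: vertices_def)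

lemma tree_height_Base_le:
  assumes "T \<noteq> Leaf"
  shows "tree_height (Base T) \<le> height T"
proof (rule tree_height_le)
  show "vertices (Base T) \<noteq> {}"
    using assms Nil_in_positions[of T] by (auto simp: vertices_Base simp del: Nil_in_positions)
  fix v assume "is_vertex (Base T) v"
  then obtain p where p: "p \<in> positions T" "v = [p]" by (auto simp: is_vertex_Base_iff)
  have "graph_dist (Base T) tree_root v \<le> length p"
    unfolding p(2) by (intro graph_dist_le walk_first_level[OF p(1)] is_child.intros)
  then show "graph_dist (Base T) tree_root v \<le> height T"
    using length_position[OF p(1)] by simp
qed

text \<open>Walk through the first level to \<open>p\<close>, cross the joining edge, then follow a
  shortest walk inside the attached tree. The joining edge is paid for by the strict inequality
  \<open>length p < height T\<close>.\<close>

lemma tree_height_Level_le: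
  assumes "T \<noteq> Leaf" "\<And>t. t \<in> set_tree T \<Longrightarrow> tree_height t \<le> m"
  shows "tree_height (Level T) \<le> height T + m"
proof (rule tree_height_le)
  show "vertices (Level T) \<noteq> {}"
    using assms Nil_in_positions[of T] by (auto simp: vertices_Level simp del: Nil_in_positions)
  fix v assume "is_vertex (Level T) v"
  then consider (first) p where "p \<in> positions T" "v = [p]"
    | (attached) p t w where "label_at T p = Some t" "is_vertex t w" "v = p # w"
    by (auto simp: is_vertex_Level_iff)
  then show "graph_dist (Level T) tree_root v \<le> height T + m"
  proof cases
    case first
    have "graph_dist (Level T) tree_root v \<le> length p"
      unfolding first(2) by (intro graph_dist_le walk_first_level[OF first(1)] is_child.intros)
    then show ?thesis using length_position[OF first(1)] by simp
  next
    case attached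
    let ?k = "graph_dist t tree_root w"
    have p: "p \<in> positions T" using attached by (auto simp: positions_def)
    have "(tree_root, [p]) \<in> adjacency (Level T) ^^ length p"
      by (intro walk_first_level[OF p] is_child.intros)
    moreover have "([p], p # tree_root) \<in> adjacency (Level T)"
      using p by (auto simp: adjacency_def tree_root_def intro: is_child.intros)
    ultimately have "(tree_root, p # tree_root) \<in> adjacency (Level T) ^^ Suc (length p)"
      by auto
    moreover have "(p # tree_root, p # w) \<in> adjacency (Level T) ^^ ?k"
      by (rule walk_lift[OF attached(1) walk_graph_dist[OF attached(2)]])
    ultimately have "(tree_root, v) \<in> adjacency (Level T) ^^ (Suc (length p) + ?k)"
      unfolding relpow_add attached(3) by blast
    then have "graph_dist (Level T) tree_root v \<le> Suc (length p) + ?k"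
      by (rule graph_dist_le)
    moreover have "?k \<le> m"
      using graph_dist_le_tree_height[OF attached(2)] assms(2)[OF label_at_in_set_tree[OF attached(1)]]
      by simp
    ultimately show ?thesis using length_position[OF p] by simp
  qed
qed

lemma sum_positions_label_at:
  "(\<Sum>p\<in>positions T. g (the (label_at T p))) = sum_list (map g (inorder T))"
proof (induction T)
  case (Node l a r)
  have "(\<Sum>p\<in>positions (Node l a r). g (the (label_at (Node l a r) p))) =
     g a + (\<Sum>p\<in>Cons Lft ` positions l \<union> Cons Rgt ` positions r. g (the (label_at (Node l a r) p)))"
    unfolding positions_Node by (subst sum.insert) auto
  also have "\<dots> = g a + (\<Sum>p\<in>Cons Lft ` positions l. g (the (label_at (Node l a r) p)))
     + (\<Sum>p\<in>Cons Rgt ` positions r. g (the (label_at (Node l a r) p)))"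
    by (subst sum.union_disjoint) (auto simp: add.assoc)
  also have "\<dots> = g a + sum_list (map g (inorder l)) + sum_list (map g (inorder r))"
    by (simp add: sum.reindex Node)
  finally show ?case by (simp add: ac_simps)
qed simp

text \<open>As \<open>size T\<close> is the length of \<open>inorder T\<close>, the total size
  depends on the list of attached trees alone and not on the shape of the first level.\<close>

lemma num_vertices_Level_inorder:
  "num_vertices (Level T) = size T + sum_list (map num_vertices (inorder T))"
  unfolding num_vertices_Level sum_positions_label_at ..

subsection \<open>Conditioning on labels and on sizes\<close>

text \<open>The law of total probability in counting form. The conditioning variable
  \<open>g\<close> will be the list of attached trees, and then the tree of their sizes.\<close>

lemma card_le_fiberwise:
  assumes "finite A"
    and "\<And>y. real (card {a \<in> A. g a = y \<and> P a}) \<le> K * real (card {a \<in> A. g a = y})"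
  shows "real (card {a \<in> A. P a}) \<le> K * real (card A)"
proof -
  have eq: "real (card {a \<in> A. Q a}) = (\<Sum>y\<in>g ` A. real (card {a \<in> A. g a = y \<and> Q a}))" for Q
  proof -
    have "card {a \<in> A. Q a} = card (\<Union>y\<in>g ` A. {a \<in> A. g a = y \<and> Q a})"
      by (rule arg_cong[of _ _ card]) auto
    also have "\<dots> = (\<Sum>y\<in>g ` A. card {a \<in> A. g a = y \<and> Q a})"
      using assms(1) by (intro card_UN_disjoint) auto
    finally show ?thesis by simp
  qed
  have "real (card {a \<in> A. P a}) \<le> (\<Sum>y\<in>g ` A. K * real (card {a \<in> A. g a = y}))"
    unfolding eq[of P] by (intro sum_mono assms(2))
  also have "\<dots> = K * real (card A)"
    using eq[of "\<lambda>_. True"] by (simp add: sum_distrib_left)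
  finally show ?thesis .
qed

section \<open>Labelled trees as a shape with a list of labels\<close>

abbreviation shape :: "'a tree \<Rightarrow> unit tree" where
  "shape \<equiv> map_tree (\<lambda>_. ())"

lemma shape_inorder_inj: "shape T = shape T' \<Longrightarrow> inorder T = inorder T' \<Longrightarrow> T = T'"
proof (induction T arbitrary: T')
  case Leaf
  then show ?case by (cases T') auto
next
  case (Node l a r)
  then obtain l' a' r' where T': "T' = Node l' a' r'" by (cases T') auto
  then have "shape l = shape l'" "shape r = shape r'" using Node.prems by auto
  \<comment> \<open>Equal shapes make both inorder lists split at the same place.\<close>
  moreover from this have "length (inorder l) = length (inorder l')"
    by (metis length_inorder size_map_tree)
  ultimately show ?case using Node T' by (auto simp: append_eq_append_conv)
qed

lemma ex_tree_shape_inorder: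
  "size S = length xs \<Longrightarrow> \<exists>T. shape T = S \<and> inorder T = xs"
proof (induction S arbitrary: xs)
  case (Node l u r)
  let ?k = "size l"
  obtain L where L: "shape L = l" "inorder L = take ?k xs"
    using Node.IH(1)[of "take ?k xs"] Node.prems by auto
  have "size r = length (drop (Suc ?k) xs)" using Node.prems by (auto simp: length_drop)
  then obtain R where R: "shape R = r" "inorder R = drop (Suc ?k) xs"
    using Node.IH(2) by blast
  have "xs = take ?k xs @ xs ! ?k # drop (Suc ?k) xs"
    using Node.prems by (intro id_take_nth_drop) auto
  then show ?case using L R by (intro exI[of _ "Node L (xs ! ?k) R"]) auto
qed simp

text \<open>For a fixed list of labels each shape of matching size occurs exactly once, so the first
  level is uniform given the labels.\<close>

lemma card_shape_inorder:
  "card {T. inorder T = xs \<and> P (shape T)} = card {S. size S = length xs \<and> P S}"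
proof (rule bij_betw_same_card[of shape])
  show "bij_betw shape {T. inorder T = xs \<and> P (shape T)} {S. size S = length xs \<and> P S}"
    unfolding bij_betw_def
  proof
    show "inj_on shape {T. inorder T = xs \<and> P (shape T)}"
      by (rule inj_onI) (auto intro: shape_inorder_inj)
    show "shape ` {T. inorder T = xs \<and> P (shape T)} = {S. size S = length xs \<and> P S}"
    proof (intro equalityI subsetI)
      fix S assume "S \<in> {S. size S = length xs \<and> P S}"
      then show "S \<in> shape ` {T. inorder T = xs \<and> P (shape T)}"
        using ex_tree_shape_inorder[of S xs] by blast
    qed auto
  qed
qed

text \<open>Once the sizes are fixed, \<open>F S\<close> is a product with one factor per vertex.
  The union bound adds up the bounds \<open>K * s\<close>, and their linearity in \<open>s\<close>
  turns the sum into \<open>K\<close> times the total size.\<close>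

lemma trees_by_sizes:
  fixes g :: "'a \<Rightarrow> nat" and A :: "'a set" and K :: real
  defines "F \<equiv> \<lambda>S. {T. map_tree g T = S \<and> set_tree T \<subseteq> A}"
  assumes fin: "\<And>s. finite {t \<in> A. g t = s}"
    and K: "K \<ge> 0"
    and bad: "\<And>s. s \<le> n \<Longrightarrow>
      real (card {t \<in> A. g t = s \<and> bad t}) \<le> K * real s * real (card {t \<in> A. g t = s})"
    and S: "sum_list (inorder S) \<le> n"
  shows "finite (F S) \<and> real (card {T \<in> F S. \<exists>t\<in>set_tree T. bad t}) \<le>
    K * real (sum_list (inorder S)) * real (card (F S))"
  using S
proof (induction S)
  case Leaf
  have F: "F Leaf = {Leaf}" by (auto simp: F_def)
  show ?case unfolding F by (simp add: Collect_conv_if)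
next
  case (Node l s r)
  let ?N = "\<lambda>(a, t, b). Node a t b :: 'a tree"
  let ?A = "{t \<in> A. g t = s}"
  let ?bad = "\<lambda>S. {T \<in> F S. \<exists>t\<in>set_tree T. bad t}"
  have l: "finite (F l)" "real (card (?bad l)) \<le> K * real (sum_list (inorder l)) * real (card (F l))"
    using Node by auto
  have r: "finite (F r)" "real (card (?bad r)) \<le> K * real (sum_list (inorder r)) * real (card (F r))"
    using Node by auto
  have s: "real (card {t \<in> ?A. bad t}) \<le> K * real s * real (card ?A)"
    using bad[of s] Node.prems by (simp add: conj_assoc)
  have F: "F (Node l s r) = ?N ` (F l \<times> ?A \<times> F r)"
  proof (intro equalityI subsetI)
    fix T assume T: "T \<in> F (Node l s r)"
    then obtain a t b where "T = Node a t b" by (cases T) (auto simp: F_def)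
    then show "T \<in> ?N ` (F l \<times> ?A \<times> F r)"
      using T by (intro image_eqI[of _ _ "(a, t, b)"]) (auto simp: F_def)
  qed (auto simp: F_def)
  have inj: "inj_on ?N X" for X by (auto simp: inj_on_def)
  have cF: "card (F (Node l s r)) = card (F l) * card ?A * card (F r)"
    unfolding F by (simp add: card_image[OF inj] card_cartesian_product mult.assoc)
  \<comment> \<open>A bad label lies in the left subtree, at the root or in the right subtree; each
    case restricts one factor of the product.\<close>
  let ?X1 = "?bad l \<times> ?A \<times> F r" and ?X2 = "F l \<times> {t \<in> ?A. bad t} \<times> F r" and ?X3 = "F l \<times> ?A \<times> ?bad r"
  have "?bad (Node l s r) \<subseteq> ?N ` (?X1 \<union> ?X2 \<union> ?X3)"
  proof
    fix T assume "T \<in> ?bad (Node l s r)"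
    then have "T \<in> ?N ` (F l \<times> ?A \<times> F r)" and bad_T: "\<exists>t\<in>set_tree T. bad t"
      unfolding F by blast+
    then obtain a t b where T: "T = Node a t b" "a \<in> F l" "t \<in> ?A" "b \<in> F r"
      by auto
    then have "(a, t, b) \<in> ?X1 \<union> ?X2 \<union> ?X3" using bad_T by auto
    then have "?N (a, t, b) \<in> ?N ` (?X1 \<union> ?X2 \<union> ?X3)" by (rule imageI)
    then show "T \<in> ?N ` (?X1 \<union> ?X2 \<union> ?X3)" by (simp only: T(1) prod.case)
  qed
  moreover have fin3: "finite (?X1 \<union> ?X2 \<union> ?X3)"
    using l(1) r(1) fin[of s] finite_subset[OF _ fin[of s], of "{t \<in> ?A. bad t}"]
    by (intro finite_UnI finite_cartesian_product) auto
  ultimately have "card (?bad (Node l s r)) \<le> card (?X1 \<union> ?X2 \<union> ?X3)"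
    by (meson card_image_le card_mono finite_imageI le_trans)
  also have "\<dots> \<le> card ?X1 + card ?X2 + card ?X3"
    using card_Un_le[of "?X1 \<union> ?X2" ?X3] card_Un_le[of ?X1 ?X2] by linarith
  finally have "real (card (?bad (Node l s r))) \<le> real (card ?X1 + card ?X2 + card ?X3)"
    by (simp only: of_nat_le_iff)
  also have "\<dots> = real (card (?bad l)) * (real (card ?A) * real (card (F r)))
      + real (card {t \<in> ?A. bad t}) * (real (card (F l)) * real (card (F r)))
      + real (card (?bad r)) * (real (card (F l)) * real (card ?A))"
    by (simp only: card_cartesian_product of_nat_add of_nat_mult mult_ac)
  also have "\<dots> \<le> K * real (sum_list (inorder l)) * real (card (F l)) * (real (card ?A) * real (card (F r)))
      + K * real s * real (card ?A) * (real (card (F l)) * real (card (F r)))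
      + K * real (sum_list (inorder r)) * real (card (F r)) * (real (card (F l)) * real (card ?A))"
    by (intro add_mono mult_right_mono l(2) s r(2)) auto
  also have "\<dots> = K * real (sum_list (inorder (Node l s r))) * real (card (F (Node l s r)))"
    unfolding cF by (simp only: of_nat_mult) (simp add: algebra_simps)
  finally have "real (card (?bad (Node l s r))) \<le>
      K * real (sum_list (inorder (Node l s r))) * real (card (F (Node l s r)))" .
  moreover have "finite (F (Node l s r))"
    unfolding F using l(1) r(1) fin[of s] by auto
  ultimately show ?case by blast
qed

subsection \<open>Induction on the number of levels\<close>

text \<open>Counting form of the claim, free of division by the number of trees and hence meaningful
  for \<open>n < d\<close> too.\<close>

definition height_tail_bound :: "nat \<Rightarrow> bool" where
  "height_tail_bound d \<longleftrightarrow> (\<exists>C c :: real. C > 0 \<and> c > 0 \<and> (\<forall>n x. x > 0 \<longrightarrow>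
     real (card {t \<in> trees_of_size d n. x \<le> real (tree_height t)}) \<le>
     C * exp (- c * x\<^sup>2 / real n) * real (card (trees_of_size d n))))"

lemma trees_of_size_0: "trees_of_size d 0 = {}"
  using tree_class_num_vertices_ge[of _ d] by (cases d) (fastforce simp: trees_of_size_def)+

lemma height_tail_bound_1: "height_tail_bound (Suc 0)"
  unfolding height_tail_bound_def
proof (intro exI conjI allI impI)
  fix n :: nat and x :: real assume x: "x > 0"
  let ?U = "{T :: unit tree. size T = n}"
  show "real (card {t \<in> trees_of_size (Suc 0) n. x \<le> real (tree_height t)}) \<le>
    128 * exp (- (1 / 64) * x\<^sup>2 / real n) * real (card (trees_of_size (Suc 0) n))"
  proof (cases "n = 0")
    case False
    have eq: "trees_of_size (Suc 0) n = Base ` ?U"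
    proof (intro equalityI subsetI)
      fix t assume "t \<in> trees_of_size (Suc 0) n"
      then obtain T where "t = Base T" "num_vertices (Base T) = n"
        unfolding trees_of_size_def by auto
      then show "t \<in> Base ` ?U" by (simp add: num_vertices_Base)
    next
      fix t assume "t \<in> Base ` ?U"
      then obtain T where "t = Base T" "size T = n" by blast
      moreover from this have "T \<noteq> Leaf" using False by auto
      ultimately show "t \<in> trees_of_size (Suc 0) n"
        by (simp add: trees_of_size_def num_vertices_Base)
    qed
    have "{t \<in> trees_of_size (Suc 0) n. x \<le> real (tree_height t)} \<subseteq>
        Base ` {T. size T = n \<and> x \<le> real (height T)}"
    proof
      fix t assume t: "t \<in> {t \<in> trees_of_size (Suc 0) n. x \<le> real (tree_height t)}"
      then obtain T where T: "t = Base T" "size T = n" unfolding eq by auto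
      then have "tree_height t \<le> height T" using tree_height_Base_le[of T] False by (cases T) auto
      then show "t \<in> Base ` {T. size T = n \<and> x \<le> real (height T)}" using T t by auto
    qed
    then have "card {t \<in> trees_of_size (Suc 0) n. x \<le> real (tree_height t)} \<le>
        card (Base ` {T. size T = n \<and> x \<le> real (height T)})"
      by (rule card_mono[rotated]) (auto intro: finite_subset[OF _ finite_trees_size[of n]])
    also have "\<dots> = card {T :: unit tree. size T = n \<and> x \<le> real (height T)}"
      by (simp add: card_image inj_on_def)
    finally have "real (card {t \<in> trees_of_size (Suc 0) n. x \<le> real (tree_height t)}) \<le>
        real (card {T :: unit tree. size T = n \<and> x \<le> real (height T)})" by simp
    also have "\<dots> \<le> 128 * exp (- x\<^sup>2 / (64 * real n)) * real (card ?U)"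
      by (rule binary_tree_height_tail) (use x False in auto)
    also have "card ?U = card (trees_of_size (Suc 0) n)"
      unfolding eq by (simp add: card_image inj_on_def)
    finally show ?thesis by simp
  qed (simp add: trees_of_size_0)
qed simp_all

section \<open>Contributions of the first level and of the attached trees\<close>

lemma card_first_level_height_ge:
  fixes d n :: nat and y :: real
  assumes "y > 0" "n > 0"
  defines "A \<equiv> {T. Level T \<in> trees_of_size (Suc (Suc d)) n}"
  shows "real (card {T \<in> A. y \<le> real (height T)}) \<le>
    128 * exp (- y\<^sup>2 / (64 * real n)) * real (card A)"
proof (rule card_le_fiberwise[of _ inorder])
  have "A = Level -` trees_of_size (Suc (Suc d)) n" by (auto simp: A_def)
  then show "finite A" by (simp add: finite_vimageI inj_def)
next
  fix xs
  show "real (card {T \<in> A. inorder T = xs \<and> y \<le> real (height T)}) \<le>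
    128 * exp (- y\<^sup>2 / (64 * real n)) * real (card {T \<in> A. inorder T = xs})"
  proof (cases "{T \<in> A. inorder T = xs} = {}")
    case True
    then have e: "{T \<in> A. inorder T = xs \<and> y \<le> real (height T)} = {}" by blast
    show ?thesis unfolding e by simp
  next
    case False
    then obtain T0 where T0: "T0 \<in> A" "inorder T0 = xs" by blast
    \<comment> \<open>Membership in \<open>A\<close> depends only on the inorder list, so each
      nonempty fibre consists of all trees with that list.\<close>
    have inA: "T \<in> A" if "inorder T = xs" for T
    proof -
      have "size T = size T0" "set_tree T = set_tree T0"
        using that T0(2) by (metis length_inorder, metis set_inorder)
      moreover have "T \<noteq> Leaf \<longleftrightarrow> T0 \<noteq> Leaf"
        using \<open>size T = size T0\<close> by (metis eq_size_0)
      ultimately show ?thesis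
        using that T0 by (auto simp: A_def trees_of_size_def num_vertices_Level_inorder)
    qed
    let ?m = "length xs"
    have "T0 \<noteq> Leaf" "num_vertices (Level T0) = n" using T0 by (auto simp: A_def trees_of_size_def)
    moreover have m: "?m = size T0" using T0(2) by (metis length_inorder)
    ultimately have m: "0 < ?m" "?m \<le> n"
      by (cases T0; auto simp: num_vertices_Level_inorder)+
    have fiber: "{T \<in> A. inorder T = xs} = {T. inorder T = xs}" using inA by blast
    have "{T \<in> A. inorder T = xs \<and> y \<le> real (height T)} = {T. inorder T = xs \<and> y \<le> real (height (shape T))}"
      using inA by auto
    then have "real (card {T \<in> A. inorder T = xs \<and> y \<le> real (height T)}) =
        real (card {S :: unit tree. size S = ?m \<and> y \<le> real (height S)})"
      using card_shape_inorder[of xs "\<lambda>S. y \<le> real (height S)"] by simp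
    also have "\<dots> \<le> 128 * exp (- y\<^sup>2 / (64 * real ?m)) * real (card {S :: unit tree. size S = ?m})"
      by (rule binary_tree_height_tail[OF assms(1) m(1)])
    also have "card {S :: unit tree. size S = ?m} = card {T \<in> A. inorder T = xs}"
      using card_shape_inorder[of xs "\<lambda>_. True"] unfolding fiber by simp
    also have "128 * exp (- y\<^sup>2 / (64 * real ?m)) * real (card {T \<in> A. inorder T = xs}) \<le>
        128 * exp (- y\<^sup>2 / (64 * real n)) * real (card {T \<in> A. inorder T = xs})"
    proof -
      have "y\<^sup>2 / (64 * real n) \<le> y\<^sup>2 / (64 * real ?m)"
        using m assms(2) by (intro divide_left_mono mult_pos_pos) auto
      then show ?thesis by (intro mult_right_mono mult_left_mono) auto
    qed
    finally show ?thesis .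
  qed
qed

text \<open>
  Half of the exponent pays for a factor linear in \<open>m\<close>, so that a union bound over all attached trees
  costs only their total size.
\<close>

lemma exp_neg_divide_le:
  fixes a m n :: real
  assumes "a > 0" "0 < m" "m \<le> n"
  shows "exp (- (a / m)) \<le> 2 / a * exp (- (a / (2 * n))) * m"
proof -
  have "a / (2 * m) \<le> exp (a / (2 * m))"
    using exp_ge_add_one_self[of "a / (2 * m)"] by linarith
  then have "exp (- (a / (2 * m))) \<le> 2 / a * m"
    using assms by (simp add: exp_minus field_simps)
  moreover have "exp (- (a / (2 * m))) \<le> exp (- (a / (2 * n)))"
  proof -
    have "a / (2 * n) \<le> a / (2 * m)" using assms by (intro divide_left_mono) auto
    then show ?thesis by simp
  qed
  ultimately have "exp (- (a / (2 * m))) * exp (- (a / (2 * m))) \<le> exp (- (a / (2 * n))) * (2 / a * m)"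
    by (intro mult_mono) auto
  moreover have "exp (- (a / m)) = exp (- (a / (2 * m))) * exp (- (a / (2 * m)))"
    by (simp flip: exp_add)
  ultimately show ?thesis by (simp add: mult_ac)
qed

text \<open>Within a fibre of fixed sizes, the bound of the previous level is first made linear in
  the size of the attached tree; the union bound then costs a factor of at most
  \<open>n\<close>.\<close>

lemma card_attached_height_ge:
  fixes d n :: nat and C a y :: real
  assumes "a > 0" "n > 0" "C \<ge> 0"
    and IH: "\<And>s. real (card {t \<in> trees_of_size (Suc d) s. y \<le> real (tree_height t)}) \<le>
      C * exp (- (a / real s)) * real (card (trees_of_size (Suc d) s))"
  defines "A \<equiv> {T. Level T \<in> trees_of_size (Suc (Suc d)) n}"
  shows "real (card {T \<in> A. \<exists>t\<in>set_tree T. y \<le> real (tree_height t)}) \<le>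
    C * (2 / a) * exp (- (a / (2 * real n))) * real n * real (card A)"
proof (rule card_le_fiberwise[of _ "map_tree num_vertices"])
  have "A = Level -` trees_of_size (Suc (Suc d)) n" by (auto simp: A_def)
  then show "finite A" by (simp add: finite_vimageI inj_def)
next
  fix S
  define K where "K = C * (2 / a) * exp (- (a / (2 * real n)))"
  have K: "K \<ge> 0" using assms by (simp add: K_def)
  let ?F = "{T. map_tree num_vertices T = S \<and> set_tree T \<subseteq> tree_class (Suc d)}"
  let ?bad = "\<lambda>T. \<exists>t\<in>set_tree T. y \<le> real (tree_height t)"
  have "real (card {T \<in> A. map_tree num_vertices T = S \<and> ?bad T}) \<le>
    K * real n * real (card {T \<in> A. map_tree num_vertices T = S})"
  proof (cases "{T \<in> A. map_tree num_vertices T = S} = {}")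
    case True
    then have e: "{T \<in> A. map_tree num_vertices T = S \<and> ?bad T} = {}" by blast
    show ?thesis unfolding e using K by simp
  next
    case False
    then obtain T0 where T0: "T0 \<in> A" "map_tree num_vertices T0 = S" by blast
    have num: "num_vertices (Level T) = size S + sum_list (inorder S)" if "map_tree num_vertices T = S" for T
      using that by (auto simp: num_vertices_Level_inorder inorder_map)
    have n: "n = size S + sum_list (inorder S)" "S \<noteq> Leaf"
      using T0 num[OF T0(2)] by (auto simp: A_def trees_of_size_def)
    have AF: "{T \<in> A. map_tree num_vertices T = S} = ?F"
      using num n by (auto simp: A_def trees_of_size_def)
    have fin: "finite {t \<in> tree_class (Suc d). num_vertices t = s}" for s
      using finite_trees_of_size[of "Suc d" s] by (simp add: trees_of_size_def)
    have "real (card {t \<in> tree_class (Suc d). num_vertices t = s \<and> y \<le> real (tree_height t)}) \<le>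
      K * real s * real (card {t \<in> tree_class (Suc d). num_vertices t = s})" if "s \<le> n" for s
    proof (cases "s = 0")
      \<comment> \<open>Here \<open>IH\<close> only gives \<open>exp (- (a / 0)) = 1\<close>, so the
        emptiness of the class is used instead.\<close>
      case True
      then have e: "{t \<in> tree_class (Suc d). num_vertices t = s \<and> y \<le> real (tree_height t)} = {}"
        using tree_class_num_vertices_ge[of _ "Suc d"] by fastforce
      show ?thesis unfolding e using K by simp
    next
      case s: False
      have "C * exp (- (a / real s)) \<le> K * real s"
        using mult_left_mono[OF exp_neg_divide_le[of a "real s" "real n"] assms(3)] assms(1) that s
        by (simp add: K_def mult_ac)
      then have "C * exp (- (a / real s)) * real (card (trees_of_size (Suc d) s)) \<le>
          K * real s * real (card (trees_of_size (Suc d) s))"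
        by (rule mult_right_mono) simp
      then show ?thesis using IH[of s] by (simp add: trees_of_size_def conj_assoc)
    qed
    from trees_by_sizes[of "tree_class (Suc d)" num_vertices K n "\<lambda>t. y \<le> real (tree_height t)" S, OF fin K this]
    have "real (card {T \<in> ?F. ?bad T}) \<le> K * real (sum_list (inorder S)) * real (card ?F)"
      using n by simp
    also have "\<dots> \<le> K * real n * real (card ?F)"
      using n K by (intro mult_right_mono mult_left_mono) auto
    also have "{T \<in> ?F. ?bad T} = {T \<in> A. map_tree num_vertices T = S \<and> ?bad T}"
      using AF by blast
    finally show ?thesis unfolding AF .
  qed
  then show "real (card {T \<in> A. map_tree num_vertices T = S \<and> ?bad T}) \<le>
    C * (2 / a) * exp (- (a / (2 * real n))) * real n * real (card {T \<in> A. map_tree num_vertices T = S})"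
    unfolding K_def .
qed

lemma height_tail_bound_Suc:
  assumes "height_tail_bound (Suc d)"
  shows "height_tail_bound (Suc (Suc d))"
proof -
  obtain C c :: real where C: "C > 0" and c: "c > 0" and
    IH: "\<And>n x. x > 0 \<Longrightarrow> real (card {t \<in> trees_of_size (Suc d) n. x \<le> real (tree_height t)}) \<le>
      C * exp (- c * x\<^sup>2 / real n) * real (card (trees_of_size (Suc d) n))"
    using assms unfolding height_tail_bound_def by blast
  \<comment> \<open>Each part is tested against \<open>x / 2\<close>: the first level gives
    \<open>1 / (4 * 64)\<close>, and the attached trees give \<open>c / 4\<close>, halved by the
    union bound.\<close>
  define c' where "c' = min (1 / 256) (c / 8)"
  have c'_le: "c' \<le> c / 8" "c' \<le> 1 / 256" by (simp_all add: c'_def)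
  define C' where "C' = 128 + 2 * C"
  show ?thesis
    unfolding height_tail_bound_def
  proof (rule exI[of _ C'], rule exI[of _ c'], intro conjI allI impI)
    fix n :: nat and x :: real assume x: "x > 0"
    let ?F = "trees_of_size (Suc (Suc d)) n"
    let ?A = "{T. Level T \<in> ?F}"
    let ?E = "exp (- c' * x\<^sup>2 / real n)"
    define a where "a = c * x\<^sup>2 / 4"
    have a: "a > 0" using x c by (simp add: a_def)
    show "real (card {t \<in> ?F. x \<le> real (tree_height t)}) \<le> C' * ?E * real (card ?F)"
    proof (cases "n = 0")
      case False
      then have n: "n > 0" by simp
      have E: "exp (- (b * x\<^sup>2 / real n)) \<le> ?E" if "c' \<le> b" for b
        using that n by (simp add: divide_right_mono mult_right_mono)
      show ?thesis
      proof (cases "a \<le> real n")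
        \<comment> \<open>The exponent is at most 1, so the claimed factor is at least
          \<open>128 / 3\<close> and the bound is trivial.\<close>
        case True
        have "a / (2 * real n) \<le> 1" using True n by (simp add: field_simps)
        moreover have "a / (2 * real n) = c / 8 * x\<^sup>2 / real n" by (simp add: a_def)
        ultimately have "exp (-1) \<le> exp (- (c / 8 * x\<^sup>2 / real n))" by simp
        moreover have "exp (-1 :: real) \<ge> 1 / 3" using exp_le by (simp add: exp_minus field_simps)
        ultimately have "1 / 3 \<le> ?E" using E[OF c'_le(1)] by linarith
        then have "1 \<le> 128 * ?E" by simp
        also have "\<dots> \<le> C' * ?E" using C by (simp add: C'_def)
        finally have "1 * real (card ?F) \<le> C' * ?E * real (card ?F)"
          by (rule mult_right_mono) simp
        moreover have "card {t \<in> ?F. x \<le> real (tree_height t)} \<le> card ?F"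
          by (rule card_mono) auto
        ultimately show ?thesis by linarith
      next
        case False
        let ?B1 = "{T \<in> ?A. x / 2 \<le> real (height T)}"
        let ?B2 = "{T \<in> ?A. \<exists>t\<in>set_tree T. x / 2 \<le> real (tree_height t)}"
        have F: "?F = Level ` ?A" by (auto simp: trees_of_size_def)
        have finA: "finite ?A"
          using finite_vimageI[of ?F Level] by (simp add: inj_def vimage_def)
        have "{t \<in> ?F. x \<le> real (tree_height t)} \<subseteq> Level ` (?B1 \<union> ?B2)"
        proof
          fix t assume t: "t \<in> {t \<in> ?F. x \<le> real (tree_height t)}"
          then have "t \<in> Level ` ?A" using F by blast
          then obtain T where T: "t = Level T" "T \<in> ?A" by blast
          have "T \<in> ?B1 \<union> ?B2"
          proof (rule ccontr)
            assume notin: "T \<notin> ?B1 \<union> ?B2"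
            define m where "m = Max (tree_height ` set_tree T)"
            have "T \<noteq> Leaf" using T by (auto simp: trees_of_size_def)
            then have "set_tree T \<noteq> {}" by (cases T) auto
            then have "m \<in> tree_height ` set_tree T" unfolding m_def by (intro Max_in) auto
            then have "real m < x / 2" using notin T by auto
            moreover have "real (height T) < x / 2" using notin T by auto
            moreover have "tree_height t \<le> height T + m"
              unfolding T(1) by (rule tree_height_Level_le[OF \<open>T \<noteq> Leaf\<close>]) (simp add: m_def)
            ultimately show False using t by simp
          qed
          then show "t \<in> Level ` (?B1 \<union> ?B2)" using T by blast
        qed
        then have "card {t \<in> ?F. x \<le> real (tree_height t)} \<le> card (Level ` (?B1 \<union> ?B2))"
          using finA by (intro card_mono) auto
        also have "\<dots> \<le> card (?B1 \<union> ?B2)" using finA by (intro card_image_le) auto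
        also have "\<dots> \<le> card ?B1 + card ?B2" by (rule card_Un_le)
        finally have "real (card {t \<in> ?F. x \<le> real (tree_height t)}) \<le> real (card ?B1) + real (card ?B2)"
          by linarith
        also have "real (card ?B1) \<le> 128 * exp (- (x / 2)\<^sup>2 / (64 * real n)) * real (card ?A)"
          using card_first_level_height_ge[of "x / 2" n d] x n by simp
        also have "\<dots> \<le> 128 * ?E * real (card ?A)"
          using E[OF c'_le(2)] by (intro mult_right_mono mult_left_mono) (auto simp: power_divide)
        also have "real (card ?B2) \<le> C * (2 / a) * exp (- (a / (2 * real n))) * real n * real (card ?A)"
        proof (rule card_attached_height_ge[OF a n less_imp_le[OF C]])
          fix s
          have e: "- (a / real s) = - c * (x / 2)\<^sup>2 / real s" by (simp add: a_def power_divide)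
          show "real (card {t \<in> trees_of_size (Suc d) s. x / 2 \<le> real (tree_height t)}) \<le>
              C * exp (- (a / real s)) * real (card (trees_of_size (Suc d) s))"
            unfolding e by (rule IH) (use x in simp)
        qed
        also have "\<dots> \<le> 2 * C * ?E * real (card ?A)"
        proof -
          \<comment> \<open>Since \<open>a > n\<close>, the factor \<open>n\<close> lost in the
            union bound is cancelled, which leaves the summand \<open>2 * C\<close> of
            \<open>C'\<close>.\<close>
          have "2 / a * real n \<le> 2" using False a by (simp add: field_simps)
          moreover have "exp (- (a / (2 * real n))) \<le> ?E" using E[OF c'_le(1)] by (simp add: a_def)
          ultimately have "(2 / a * real n) * exp (- (a / (2 * real n))) \<le> 2 * ?E"
            by (intro mult_mono) auto
          then have "C * ((2 / a * real n) * exp (- (a / (2 * real n)))) \<le> C * (2 * ?E)"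
            using C by (intro mult_left_mono) auto
          then have "C * ((2 / a * real n) * exp (- (a / (2 * real n)))) * real (card ?A) \<le> C * (2 * ?E) * real (card ?A)"
            by (rule mult_right_mono) simp
          then show ?thesis by (simp add: mult_ac)
        qed
        also have "128 * ?E * real (card ?A) + 2 * C * ?E * real (card ?A) = C' * ?E * real (card ?A)"
          by (simp add: C'_def algebra_simps)
        also have "card ?A = card (Level ` ?A)" by (rule card_image[symmetric]) (auto intro: inj_onI)
        also have "\<dots> = card ?F" by (rule arg_cong[OF F[symmetric]])
        finally show ?thesis by simp
      qed
    qed (simp add: trees_of_size_0)
  qed (use C c in \<open>auto simp: C'_def c'_def\<close>)
qed

lemma height_tail_bound: "height_tail_bound (Suc d)"
  by (induction d) (use height_tail_bound_1 height_tail_bound_Suc in auto)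

theorem theorem1p2:
  fixes d :: nat
  assumes "d \<ge> 1"
  shows "\<exists>C c :: real. C > 0 \<and> c > 0 \<and>
    (\<forall>n :: nat. trees_of_size d n \<noteq> {} \<longrightarrow>
      (\<forall>x :: real. x > 0 \<longrightarrow>
        measure_pmf.prob (random_tree d n) {t. real (tree_height t) \<ge> x}
          \<le> C * exp (- c * x\<^sup>2 / real n)))"
proof -
  obtain C c :: real where C: "C > 0" "c > 0" and
    bound: "\<And>n x. x > 0 \<Longrightarrow> real (card {t \<in> trees_of_size d n. x \<le> real (tree_height t)}) \<le>
      C * exp (- c * x\<^sup>2 / real n) * real (card (trees_of_size d n))"
    using height_tail_bound[of "d - 1"] assms unfolding height_tail_bound_def by auto
  show ?thesis
  proof (intro exI conjI allI impI)
    fix n :: nat and x :: real assume ne: "trees_of_size d n \<noteq> {}" and x: "x > 0"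
    have "measure_pmf.prob (random_tree d n) {t. real (tree_height t) \<ge> x} =
        real (card {t \<in> trees_of_size d n. x \<le> real (tree_height t)}) / real (card (trees_of_size d n))"
      unfolding random_tree_def by (simp add: measure_pmf_of_set[OF ne] Int_def)
    also have "\<dots> \<le> C * exp (- c * x\<^sup>2 / real n)"
      using bound[OF x, of n] ne by (simp add: divide_le_eq card_gt_0_iff)
    finally show "measure_pmf.prob (random_tree d n) {t. real (tree_height t) \<ge> x} \<le>
        C * exp (- c * x\<^sup>2 / real n)" .
  qed (use C in auto)
qed

end
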